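(* Let $K$ and $M$ be infinite fields, and let $\Psi: H(K)\to H(M)$ be a group monomorphism. Then there are a group automorphism $\Phi: H(M)\to H(M)$ and a field homomorphism $\theta: K\to M$ such that $\Psi=\Phi\circ H(\theta)$.
   Context: For a field $K$, the Heisenberg group $H(K)=\mathrm{UT}_3(K)$ is the group, under matrix multiplication, of upper unitriangular $3\times 3$ matrices with coefficients in $K$. $H$ is regarded as a functor from fields to groups: for a field homomorphism $\theta:K\to M$, the group homomorphism $H(\theta):H(K)\to H(M)$ applies $\theta$ to each matrix entry. *)

theory Defs
  imports "Jordan_Normal_Form.Matrix"
begin

text \<open>The Heisenberg group \<open>UT\<^sub>3(K)\<close>; the type argument determines the field \<open>K\<close>.\<close>

definition heisenberg :: "'a :: field itself \<Rightarrow> 'a mat monoid" where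
  "heisenberg TYPE('a) =
     \<lparr> carrier = {A \<in> carrier_mat 3 3. upper_triangular A \<and> (\<forall>i < 3. A $$ (i, i) = 1)},
       mult = (*), one = 1\<^sub>m 3 \<rparr>"

definition heisenberg_map :: "('a :: field \<Rightarrow> 'b :: field) \<Rightarrow> 'a mat \<Rightarrow> 'b mat" where
  "heisenberg_map \<theta> = map_mat \<theta>"

lemma heisenberg_simps [simp]:
  "A \<in> carrier (heisenberg TYPE('a :: field)) \<longleftrightarrow>
     A \<in> carrier_mat 3 3 \<and> upper_triangular A \<and> (\<forall>i < 3. A $$ (i, i) = 1)"
  "x \<otimes>\<^bsub>heisenberg TYPE('a)\<^esub> y = x * y"
  "\<one>\<^bsub>heisenberg TYPE('a)\<^esub> = 1\<^sub>m 3"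
  by (simp_all add: heisenberg_def)

lemma heisenberg_carrier_iff:
  fixes A :: "'a :: field mat"
  shows "A \<in> carrier (heisenberg TYPE('a)) \<longleftrightarrow>
    (\<exists>x y z. A = mat_of_rows_list 3 [[1, x, z], [0, 1, y], [0, 0, 1]])"
proof
  assume "A \<in> carrier (heisenberg TYPE('a))"
  then have A: "A \<in> carrier_mat 3 3" "upper_triangular A" "\<forall>i < 3. A $$ (i, i) = 1"
    by auto
  have "A = mat_of_rows_list 3
      [[1, A $$ (0, 1), A $$ (0, 2)], [0, 1, A $$ (1, 2)], [0, 0, 1]]"
    using A
    by (intro eq_matI)
      (auto simp: mat_of_rows_list_def upper_triangular_def numeral_3_eq_3 numeral_2_eq_2 less_Suc_eq)
  then show "\<exists>x y z. A = mat_of_rows_list 3 [[1, x, z], [0, 1, y], [0, 0, 1]]"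
    by blast
qed (auto simp: mat_of_rows_list_def upper_triangular_def numeral_3_eq_3 less_Suc_eq)

lemma heisenberg_mult:
  fixes x y z x' y' z' :: "'a :: field"
  shows "mat_of_rows_list 3 [[1, x, z], [0, 1, y], [0, 0, 1]] *
         mat_of_rows_list 3 [[1, x', z'], [0, 1, y'], [0, 0, 1]] =
         mat_of_rows_list 3 [[1, x + x', z + z' + x * y'], [0, 1, y + y'], [0, 0, 1]]"
  by (rule eq_matI)
    (auto simp: mat_of_rows_list_def scalar_prod_def numeral_3_eq_3 less_Suc_eq)

lemma heisenberg_one:
  "1\<^sub>m 3 = mat_of_rows_list 3 [[1, 0, 0], [0, 1, 0], [0, 0, 1 :: 'a :: field]]"
  by (rule eq_matI) (auto simp: mat_of_rows_list_def numeral_3_eq_3 less_Suc_eq)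

lemma group_heisenberg: "group (heisenberg TYPE('a :: field))"
proof (rule groupI)
  fix A B :: "'a mat"
  assume "A \<in> carrier (heisenberg TYPE('a))" "B \<in> carrier (heisenberg TYPE('a))"
  then show "A \<otimes>\<^bsub>heisenberg TYPE('a)\<^esub> B \<in> carrier (heisenberg TYPE('a))"
    unfolding heisenberg_carrier_iff heisenberg_simps(2)
    by (elim exE) (simp only: heisenberg_mult, blast)
next
  show "\<one>\<^bsub>heisenberg TYPE('a)\<^esub> \<in> carrier (heisenberg TYPE('a))"
    unfolding heisenberg_carrier_iff heisenberg_simps(3) heisenberg_one by blast
next
  fix A :: "'a mat"
  assume "A \<in> carrier (heisenberg TYPE('a))"
  then obtain x y z where A: "A = mat_of_rows_list 3 [[1, x, z], [0, 1, y], [0, 0, 1]]"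
    unfolding heisenberg_carrier_iff by blast
  let ?B = "mat_of_rows_list 3 [[1, - x, x * y - z], [0, 1, - y], [0, 0, 1]]"
  have "?B \<in> carrier (heisenberg TYPE('a))"
    unfolding heisenberg_carrier_iff by blast
  moreover have "?B * A = 1\<^sub>m 3"
    unfolding A heisenberg_mult heisenberg_one by simp
  ultimately show "\<exists>B \<in> carrier (heisenberg TYPE('a)).
      B \<otimes>\<^bsub>heisenberg TYPE('a)\<^esub> A = \<one>\<^bsub>heisenberg TYPE('a)\<^esub>"
    by (metis heisenberg_simps(2,3))
qed auto

lemma heisenberg_map_hom:
  fixes \<theta> :: "'a :: field \<Rightarrow> 'b :: field"
  assumes "field_hom \<theta>"
  shows "heisenberg_map \<theta> \<in> hom (heisenberg TYPE('a)) (heisenberg TYPE('b))"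
proof -
  interpret field_hom \<theta> by (fact assms)
  show ?thesis
    by (auto simp: hom_def heisenberg_map_def upper_triangular_def mat_hom_mult)
qed

end

theory Submission
  imports Defs
begin

text \<open>Modulo centres, \<open>\<Psi>\<close> is an additive map \<open>K\<^sup>2 \<rightarrow> M\<^sup>2\<close>, and commutators show that it carries the
  determinant form to the determinant form up to the injective additive map \<open>g : K \<rightarrow> M\<close> induced on the
  centres. Evaluating this on the two axes gives \<open>(x, y) \<mapsto> \<theta> x p + \<theta> y q\<close> with \<open>\<theta> = g / g 1\<close>
  multiplicative and \<open>det (p, q) = g 1\<close>. The linear map with columns \<open>p\<close> and \<open>q\<close> lifts to an
  automorphism of \<open>H(M)\<close>, and the lift of its composite with \<open>H(\<theta>)\<close> differs from \<open>\<Psi>\<close> by a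
  homomorphism \<open>K\<^sup>2 \<rightarrow> M\<close> into the centre. Such a homomorphism factors through \<open>\<theta>\<close>, because \<open>\<theta>\<close> has a
  \<open>K\<close>-linear retraction, so it is absorbed into the automorphism.\<close>

definition heis :: "'a :: field \<Rightarrow> 'a \<Rightarrow> 'a \<Rightarrow> 'a mat" where
  "heis x y z = mat_of_rows_list 3 [[1, x, z], [0, 1, y], [0, 0, 1]]"

lemma heis_index [simp]:
  "heis x y z $$ (0, 1) = x" "heis x y z $$ (0, Suc 0) = x"
  "heis x y z $$ (1, 2) = y" "heis x y z $$ (Suc 0, 2) = y"
  "heis x y z $$ (0, 2) = z"
  by (simp_all add: heis_def mat_of_rows_list_def)

lemma heis_eq_iff [simp]: "heis x y z = heis x' y' z' \<longleftrightarrow> x = x' \<and> y = y' \<and> z = z'"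
  by (metis heis_index)

lemma heis_mult: "heis x y z * heis x' y' z' = heis (x + x') (y + y') (z + z' + x * y')"
  unfolding heis_def by (rule heisenberg_mult)

lemma carrier_heisenberg: "carrier (heisenberg TYPE('a :: field)) = {A :: 'a mat. \<exists>x y z. A = heis x y z}"
  using heisenberg_carrier_iff by (auto simp: heis_def simp del: heisenberg_simps(1))

lemma heisenberg_map_heis:
  assumes "field_hom \<theta>"
  shows "heisenberg_map \<theta> (heis x y z) = heis (\<theta> x) (\<theta> y) (\<theta> z)"
proof -
  interpret field_hom \<theta> by (fact assms)
  show ?thesis
    unfolding heisenberg_map_def heis_def
    by (rule eq_matI) (auto simp: mat_of_rows_list_def numeral_3_eq_3 less_Suc_eq)
qed

text \<open>The condition on \<open>f\<close> says that its defect of additivity is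
  \<open>(p1 * x + q1 * y) * (p2 * x' + q2 * y')\<close> minus
  \<open>(p1 * q2 - q1 * p2) * x * y'\<close>, which is exactly what multiplicativity of
  \<open>\<Phi>\<close> demands in the corner.\<close>

lemma heis_lift_iso:
  fixes p1 p2 q1 q2 :: "'a :: field" and f :: "'a \<Rightarrow> 'a \<Rightarrow> 'a"
  assumes det: "p1 * q2 - q1 * p2 \<noteq> 0"
    and f: "\<And>x y x' y'. f (x + x') (y + y') = f x y + f x' y' +
      p1 * p2 * x * x' + q1 * q2 * y * y' + q1 * p2 * (x * y' + y * x')"
  defines "\<Phi> \<equiv> \<lambda>A. heis (p1 * A $$ (0, 1) + q1 * A $$ (1, 2)) (p2 * A $$ (0, 1) + q2 * A $$ (1, 2))
    ((p1 * q2 - q1 * p2) * A $$ (0, 2) + f (A $$ (0, 1)) (A $$ (1, 2)))"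
  shows "\<Phi> \<in> iso (heisenberg TYPE('a)) (heisenberg TYPE('a))"
proof -
  define D where "D = p1 * q2 - q1 * p2"
  have D: "D \<noteq> 0" using det by (simp add: D_def)
  have \<Phi>: "\<Phi> (heis x y z) = heis (p1 * x + q1 * y) (p2 * x + q2 * y) (D * z + f x y)" for x y z
    by (simp add: \<Phi>_def D_def)
  \<comment> \<open>The inverse: Cramer's rule recovers \<open>x\<close> and \<open>y\<close>, after
    which the corner is solved for.\<close>
  define \<Xi> where "\<Xi> = (\<lambda>A.
    let x = (q2 * A $$ (0, 1) - q1 * A $$ (1, 2)) / D; y = (p1 * A $$ (1, 2) - p2 * A $$ (0, 1)) / D
    in heis x y ((A $$ (0, 2) - f x y) / D))"
  have \<Xi>: "\<Xi> (heis a b c) = (let x = (q2 * a - q1 * b) / D; y = (p1 * b - p2 * a) / D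
    in heis x y ((c - f x y) / D))" for a b c
    by (simp add: \<Xi>_def)
  have "q2 * (p1 * x + q1 * y) - q1 * (p2 * x + q2 * y) = D * x"
    and "p1 * (p2 * x + q2 * y) - p2 * (p1 * x + q1 * y) = D * y" for x y
    by (simp_all add: D_def algebra_simps)
  then have left: "\<Xi> (\<Phi> (heis x y z)) = heis x y z" for x y z
    using D by (simp add: \<Phi> \<Xi>)
  have "p1 * (q2 * a - q1 * b) + q1 * (p1 * b - p2 * a) = D * a"
    and "p2 * (q2 * a - q1 * b) + q2 * (p1 * b - p2 * a) = D * b" for a b
    by (simp_all add: D_def algebra_simps)
  then have "p1 * ((q2 * a - q1 * b) / D) + q1 * ((p1 * b - p2 * a) / D) = a"
    and "p2 * ((q2 * a - q1 * b) / D) + q2 * ((p1 * b - p2 * a) / D) = b" for a b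
    using D by (simp_all add: add_divide_distrib [symmetric])
  then have right: "\<Phi> (\<Xi> (heis a b c)) = heis a b c" for a b c
    using D by (simp add: \<Phi> \<Xi> Let_def)
  have "bij_betw \<Phi> (carrier (heisenberg TYPE('a))) (carrier (heisenberg TYPE('a)))"
    unfolding carrier_heisenberg
  proof (rule bij_betw_byWitness [where f' = \<Xi>])
    show "\<forall>A \<in> {A. \<exists>x y z. A = heis x y z}. \<Xi> (\<Phi> A) = A"
      using left by blast
    show "\<forall>A \<in> {A. \<exists>x y z. A = heis x y z}. \<Phi> (\<Xi> A) = A"
      using right by blast
  qed (auto simp: \<Phi> \<Xi> Let_def)
  moreover have "\<Phi> (heis x y z * heis x' y' z') = \<Phi> (heis x y z) * \<Phi> (heis x' y' z')"
    for x y z x' y' z'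
    by (simp add: \<Phi> heis_mult f D_def algebra_simps)
  then have "\<Phi> \<in> hom (heisenberg TYPE('a)) (heisenberg TYPE('a))"
    by (auto simp: hom_def carrier_heisenberg \<Phi> simp del: heisenberg_simps(1))
  ultimately show ?thesis
    by (simp add: iso_def)
qed

text \<open>Scalars acting through \<open>\<theta>\<close> make \<open>'m\<close> a vector space
  over \<open>'k\<close>, and \<open>\<theta>\<close> a linear injection, which has a linear left
  inverse.\<close>

lemma field_hom_additive_retraction:
  assumes "field_hom (\<theta> :: 'k :: field \<Rightarrow> 'm :: field)"
  obtains \<pi> where "\<And>a b. \<pi> (a + b) = \<pi> a + \<pi> b" "\<And>k. \<pi> (\<theta> k) = k"
proof -
  interpret field_hom \<theta> by (fact assms)
  interpret vector_space_pair "(*) :: 'k \<Rightarrow> 'k \<Rightarrow> 'k" "\<lambda>k m. \<theta> k * m"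
    by unfold_locales (simp_all add: hom_distribs algebra_simps)
  have "Vector_Spaces.linear (*) (\<lambda>k m. \<theta> k * m) \<theta>"
    by unfold_locales (simp_all add: hom_distribs)
  moreover have "inj \<theta>"
    by (rule inj_onI) (metis eq_iff_diff_eq_0 hom_minus hom_0_iff)
  ultimately obtain \<pi> where \<pi>: "Vector_Spaces.linear (\<lambda>k m. \<theta> k * m) (*) \<pi>" "\<pi> \<circ> \<theta> = id"
    using linear_injective_left_inverse by blast
  interpret \<pi>: Vector_Spaces.linear "\<lambda>k m. \<theta> k * m" "(*)" \<pi> by (fact \<pi>(1))
  show thesis
    using that \<pi>.add \<pi>(2) by (metis comp_apply id_apply)
qed

theorem theorem2p5:
  fixes \<Psi> :: "'k :: field mat \<Rightarrow> 'm :: field mat"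
  assumes "infinite (UNIV :: 'k set)"
    and "infinite (UNIV :: 'm set)"
    and "\<Psi> \<in> mon (heisenberg TYPE('k)) (heisenberg TYPE('m))"
  shows "\<exists>\<Phi> \<in> iso (heisenberg TYPE('m)) (heisenberg TYPE('m)).
         \<exists>\<theta> :: 'k \<Rightarrow> 'm. field_hom \<theta> \<and>
           (\<forall>A \<in> carrier (heisenberg TYPE('k)). \<Psi> A = (\<Phi> \<circ> heisenberg_map \<theta>) A)"
proof -
  have hom: "\<Psi> \<in> hom (heisenberg TYPE('k)) (heisenberg TYPE('m))"
    and inj: "inj_on \<Psi> (carrier (heisenberg TYPE('k)))"
    using assms(3) by (auto simp: mon_def)
  define a b c where "a x y z = \<Psi> (heis x y z) $$ (0, 1)" and "b x y z = \<Psi> (heis x y z) $$ (1, 2)"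
    and "c x y z = \<Psi> (heis x y z) $$ (0, 2)" for x y z
  have "\<Psi> (heis x y z) \<in> carrier (heisenberg TYPE('m))" for x y z
    using hom unfolding hom_def carrier_heisenberg by blast
  then have \<Psi>: "\<Psi> (heis x y z) = heis (a x y z) (b x y z) (c x y z)" for x y z
    unfolding carrier_heisenberg a_def b_def c_def by (smt (verit) heis_index(1,3,5) mem_Collect_eq)
  have "\<Psi> (heis x y z * heis x' y' z') = \<Psi> (heis x y z) * \<Psi> (heis x' y' z')" for x y z x' y' z'
    using hom by (auto simp: hom_def carrier_heisenberg simp del: heisenberg_simps(1))
  \<comment> \<open>Instantiations of these facts list \<open>x\<close>, \<open>x'\<close>,
    \<open>y\<close>, \<open>y'\<close>, \<open>z\<close>, \<open>z'\<close> in this order.\<close>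
  then have mult:
      "a (x + x') (y + y') (z + z' + x * y') = a x y z + a x' y' z'"
      "b (x + x') (y + y') (z + z' + x * y') = b x y z + b x' y' z'"
      "c (x + x') (y + y') (z + z' + x * y') = c x y z + c x' y' z' + a x y z * b x' y' z'"
    for x y z x' y' z'
    by (simp_all add: heis_mult \<Psi>)
  \<comment> \<open>\<open>heis 0 0 z\<close> is the commutator of \<open>heis z 0 0\<close> and
    \<open>heis 0 1 0\<close>, while \<open>a\<close> and \<open>b\<close> are homomorphisms into an
    abelian group.\<close>
  have center: "a 0 0 z = 0" "b 0 0 z = 0" for z
    using mult(1,2) [of z 0 0 1 0 0] mult(1,2) [of 0 z 1 0 0 0] mult(1,2) [of 0 z 0 1 z 0]
    by simp_all
  define g where "g z = c 0 0 z" for z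
  have g_add: "g (z + z') = g z + g z'" for z z'
    using mult(3) [of 0 0 0 0 z z'] by (simp add: g_def center)
  have g_inj: "z = z'" if "g z = g z'" for z z'
  proof -
    have "\<Psi> (heis 0 0 z) = \<Psi> (heis 0 0 z')"
      using that by (simp add: \<Psi> center g_def)
    then show ?thesis
      using inj_onD [OF inj, of "heis 0 0 z" "heis 0 0 z'"]
      by (auto simp: carrier_heisenberg simp del: heisenberg_simps(1))
  qed
  have g_comm: "g (x * y) = a x 0 0 * b 0 y 0 - a 0 y 0 * b x 0 0" for x y
    using mult(3) [of x 0 0 y 0 0] mult(3) [of 0 x y 0 0 0] mult(3) [of 0 x 0 y "x * y" 0]
    by (simp add: g_def center)
  \<comment> \<open>Elements of one axis commute, so their images have determinant zero.\<close>
  have axis1: "a x 0 0 * b x' 0 0 = a x' 0 0 * b x 0 0" for x x'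
    using mult(3) [of x x' 0 0 0 0] mult(3) [of x' x 0 0 0 0] by (simp add: add.commute)
  have axis2: "a 0 y 0 * b 0 y' 0 = a 0 y' 0 * b 0 y 0" for y y'
    using mult(3) [of 0 0 y y' 0 0] mult(3) [of 0 0 y' y 0 0] by (simp add: add.commute)
  define p1 p2 q1 q2 where "p1 = a 1 0 0" and "p2 = b 1 0 0" and "q1 = a 0 1 0" and "q2 = b 0 1 0"
  define D where "D = p1 * q2 - q1 * p2"
  have g1: "g 1 = D"
    using g_comm [of 1 1] by (simp add: D_def p1_def p2_def q1_def q2_def)
  have g0: "g 0 = 0"
    using g_add [of 0 0] by (metis add_cancel_right_right)
  have D: "D \<noteq> 0"
    using g_inj [of 1 0] g1 g0 by auto
  define \<theta> where "\<theta> x = g x / D" for x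
  have g: "g x = D * \<theta> x" for x
    using D by (simp add: \<theta>_def)
  have gx: "D * \<theta> x = a x 0 0 * q2 - q1 * b x 0 0" for x
    using g_comm [of x 1] by (simp add: g q1_def q2_def)
  have gy: "D * \<theta> y = p1 * b 0 y 0 - a 0 y 0 * p2" for y
    using g_comm [of 1 y] by (simp add: g p1_def p2_def)
  \<comment> \<open>Cramer's rule: the image of \<open>(x, 0)\<close> has determinant
    \<open>D * \<theta> x\<close> with \<open>q\<close> and zero with \<open>p\<close>, hence equals
    \<open>\<theta> x\<close> times \<open>p\<close>.\<close>
  have "D * a x 0 0 = D * \<theta> x * p1" "D * b x 0 0 = D * \<theta> x * p2" for x
    using axis1 [of x 1, folded p1_def p2_def] unfolding gx by (simp_all add: D_def algebra_simps)
  then have ab1: "a x 0 0 = \<theta> x * p1" "b x 0 0 = \<theta> x * p2" for x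
    using D by simp_all
  have "D * a 0 y 0 = D * \<theta> y * q1" "D * b 0 y 0 = D * \<theta> y * q2" for y
    using axis2 [of y 1, folded q1_def q2_def] unfolding gy by (simp_all add: D_def algebra_simps)
  then have ab2: "a 0 y 0 = \<theta> y * q1" "b 0 y 0 = \<theta> y * q2" for y
    using D by simp_all
  have \<theta>_mult: "\<theta> (x * y) = \<theta> x * \<theta> y" for x y
  proof -
    have "D * \<theta> (x * y) = D * (\<theta> x * \<theta> y)"
      using g_comm [of x y] unfolding g ab1 ab2 D_def by (simp add: algebra_simps)
    then show ?thesis using D by simp
  qed
  have \<theta>: "field_hom \<theta>"
    using D by unfold_locales (simp_all add: \<theta>_mult, simp_all add: \<theta>_def g0 g1 g_add add_divide_distrib)
  interpret \<theta>: field_hom \<theta> by (fact \<theta>)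
  obtain \<pi> where \<pi>: "\<And>a b. \<pi> (a + b) = \<pi> a + \<pi> b" "\<And>k. \<pi> (\<theta> k) = k"
    using field_hom_additive_retraction [OF \<theta>] by blast
  have c1: "c (x + x') 0 0 = c x 0 0 + c x' 0 0 + p1 * p2 * \<theta> x * \<theta> x'" for x x'
    using mult(3) [of x x' 0 0 0 0] by (simp add: ab1)
  have c2: "c 0 (y + y') 0 = c 0 y 0 + c 0 y' 0 + q1 * q2 * \<theta> y * \<theta> y'" for y y'
    using mult(3) [of 0 0 y y' 0 0] by (simp add: ab2)
  \<comment> \<open>In characteristic 2 the images of the involutions \<open>heis 1 0 0\<close> and \<open>heis 0 1 0\<close> are involutions,
    which forces \<open>p1 * p2 = 0\<close> and \<open>q1 * q2 = 0\<close>.\<close>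
  have half: "\<exists>h :: 'm. r = h + h" if "(1 :: 'k) + 1 = 0 \<Longrightarrow> r = - (s + s)" for r s :: 'm
  proof (cases "(1 :: 'k) + 1 = 0")
    case True
    then show ?thesis using that by (intro exI [of _ "- s"]) simp
  next
    case False
    then have "\<theta> (1 + 1) \<noteq> 0" by (metis \<theta>.hom_0_iff)
    then have "(2 :: 'm) \<noteq> 0" by (metis \<theta>.hom_add \<theta>.hom_one one_add_one)
    then show ?thesis by (intro exI [of _ "r / 2"]) (simp add: field_simps)
  qed
  have c0: "c 0 0 0 = 0"
    using g0 by (simp add: g_def)
  obtain h1 where h1: "p1 * p2 = h1 + h1"
    using half [of "p1 * p2" "c 1 0 0"] c1 [of 1 1] c0 by (metis \<theta>.hom_one add_eq_0_iff mult.right_neutral)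
  obtain h2 where h2: "q1 * q2 = h2 + h2"
    using half [of "q1 * q2" "c 0 1 0"] c2 [of 1 1] c0 by (metis \<theta>.hom_one add_eq_0_iff mult.right_neutral)
  \<comment> \<open>As \<open>h1 + h1 = p1 * p2\<close>, subtracting the quadratic term removes the
    defect of additivity in \<open>c1\<close>; likewise for \<open>c2\<close>.\<close>
  define t1 t2 where "t1 x = c x 0 0 - h1 * \<theta> x * \<theta> x" and "t2 y = c 0 y 0 - h2 * \<theta> y * \<theta> y" for x y
  have t1: "t1 (x + x') = t1 x + t1 x'" for x x'
    by (simp add: t1_def c1 h1 \<theta>.hom_add algebra_simps)
  have t2: "t2 (y + y') = t2 y + t2 y'" for y y'
    by (simp add: t2_def c2 h2 \<theta>.hom_add algebra_simps)
  \<comment> \<open>At \<open>(\<theta> x, \<theta> y)\<close> this is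
    \<open>c x 0 0 + c 0 y 0 + q1 * p2 * \<theta> x * \<theta> y\<close>; \<open>\<pi>\<close>
    extends the additive parts to all of \<open>'m\<close>.\<close>
  define f where
    "f x y = t1 (\<pi> x) + h1 * x * x + t2 (\<pi> y) + h2 * y * y + q1 * p2 * x * y" for x y
  define \<Phi> where "\<Phi> A = heis (p1 * A $$ (0, 1) + q1 * A $$ (1, 2)) (p2 * A $$ (0, 1) + q2 * A $$ (1, 2))
    (D * A $$ (0, 2) + f (A $$ (0, 1)) (A $$ (1, 2)))" for A
  have "\<Phi> \<in> iso (heisenberg TYPE('m)) (heisenberg TYPE('m))"
    unfolding \<Phi>_def [abs_def] D_def
  proof (rule heis_lift_iso)
    show "p1 * q2 - q1 * p2 \<noteq> 0"
      using D by (simp add: D_def)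
    show "f (x + x') (y + y') = f x y + f x' y' +
        p1 * p2 * x * x' + q1 * q2 * y * y' + q1 * p2 * (x * y' + y * x')" for x y x' y'
      by (simp add: f_def t1 t2 \<pi> h1 h2 algebra_simps)
  qed
  moreover have "\<Psi> (heis x y z) = (\<Phi> \<circ> heisenberg_map \<theta>) (heis x y z)" for x y z
  proof -
    \<comment> \<open>Here \<open>heis x y z = heis 0 y 0 * heis x 0 0 * heis 0 0 z\<close>; this
      order of factors creates no term \<open>x * y\<close> in the corner.\<close>
    have "a x y z = \<theta> x * p1 + \<theta> y * q1" "b x y z = \<theta> x * p2 + \<theta> y * q2"
      using mult(1,2) [of 0 x y 0 0 0] mult(1,2) [of x 0 y 0 0 z] by (simp_all add: ab1 ab2 center)
    moreover have "c x y z = c 0 y 0 + c x 0 0 + q1 * p2 * \<theta> x * \<theta> y + D * \<theta> z"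
      using mult(3) [of 0 x y 0 0 0] mult(3) [of x 0 y 0 0 z]
      by (simp add: ab1 ab2 center g [symmetric] g_def)
    ultimately show ?thesis
      by (simp add: heisenberg_map_heis [OF \<theta>] \<Psi> \<Phi>_def f_def \<pi> t1_def t2_def algebra_simps)
  qed
  ultimately show ?thesis
    using \<theta> unfolding carrier_heisenberg by blast
qed

end
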